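(* Let $0<p<1$. Then there exists a martingale $f\in H_p(G)$ such that $$\sup_{n\in\mathbb{N}}\Vert L_{2^n}f\Vert_{weak-L_p}=\infty .$$
   Context: Notation: $\mathbb{N}_+$ is the set of positive integers and $\mathbb{N}=\mathbb{N}_+\cup\{0\}$. $Z_2=\{0,1\}$ is the discrete group with addition modulo 2, with Haar measure giving each singleton measure $1/2$. $G$ is the complete direct product of countably many copies of $Z_2$, with the product topology; its elements are sequences $x=(x_0,x_1,\dots,x_j,\dots)$ with $x_k\in\{0,1\}$, and $\mu$ is the product (normalized Haar) measure on $G$. For $x\in G$ put $I_0(x):=G$ and $I_n(x):=\{y\in G:\ y_0=x_0,\dots,y_{n-1}=x_{n-1}\}$ for $n\in\mathbb{N}_+$. For $0<p<\infty$, $\Vert g\Vert_p^p:=\int_G|g|^p\,d\mu$ and $\Vert g\Vert_{weak-L_p}^p:=\sup_{\lambda>0}\lambda^p\mu(|g|>\lambda)$. Rademacher functions: $r_k(x):=(-1)^{x_k}$. Walsh functions: if $n=\sum_{j\ge 0}n_j2^j$ with $n_j\in\{0,1\}$ is the binary expansion of $n\in\mathbb{N}$, then $w_n(x):=\prod_{k=0}^{\infty}r_k(x)^{n_k}$. Martingales: $\mathcal{F}_n$ denotes the $\sigma$-algebra generated by $\{I_n(x):x\in G\}$, $n\in\mathbb{N}$. A martingale $f=(f^{(n)},n\in\mathbb{N})$ is taken with respect to $(\mathcal{F}_n,n\in\mathbb{N})$. Its maximal function is $f^*:=\sup_{n\in\mathbb{N}}|f^{(n)}|$, and for $0<p<\infty$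 the martingale Hardy space $H_p(G)$ consists of all martingales $f$ with $\Vert f\Vert_{H_p}:=\Vert f^*\Vert_p<\infty$. The Walsh–Fourier coefficients of a martingale $f=(f^{(n)},n\in\mathbb{N})$ are $\widehat f(i):=\lim_{k\to\infty}\int_G f^{(k)}(x)w_i(x)\,d\mu(x)$, its partial sums are $S_nf:=\sum_{k=0}^{n-1}\widehat f(k)w_k$ (with $S_0f=0$), and its Nörlund logarithmic means are, for $n\in\mathbb{N}_+$, $$L_nf:=\frac1{l_n}\sum_{k=0}^{n-1}\frac{S_kf}{n-k},\qquad l_n:=\sum_{k=1}^{n}\frac1k .$$ *)

theory Defs
  imports "HOL-Probability.Probability" "HOL-Library.Z2"
begin

subsection \<open>The Walsh group\<close>

definition walsh_measure :: "(nat \<Rightarrow> bit) measure" where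
  "walsh_measure = (\<Pi>\<^sub>M i\<in>(UNIV :: nat set). uniform_count_measure (UNIV :: bit set))"

definition dyadic_interval :: "nat \<Rightarrow> (nat \<Rightarrow> bit) \<Rightarrow> (nat \<Rightarrow> bit) set" where
  "dyadic_interval n x = {y. \<forall>k<n. y k = x k}"

text \<open>As usual in the library, a sub-\<open>\<sigma>\<close>-algebra is represented by a measure space whose own
  measure is irrelevant.\<close>

definition dyadic_algebra :: "nat \<Rightarrow> (nat \<Rightarrow> bit) measure" where
  "dyadic_algebra n = sigma UNIV (range (dyadic_interval n))"

subsection \<open>Walsh functions\<close>

definition rademacher :: "nat \<Rightarrow> (nat \<Rightarrow> bit) \<Rightarrow> real" where
  "rademacher k x = (if x k = 0 then 1 else - 1)"

definition binary_digit :: "nat \<Rightarrow> nat \<Rightarrow> nat" where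
  "binary_digit n k = (n div 2 ^ k) mod 2"

definition walsh :: "nat \<Rightarrow> (nat \<Rightarrow> bit) \<Rightarrow> real" where
  "walsh n x = (\<Prod>k. rademacher k x ^ binary_digit n k)"

subsection \<open>Quasi-norms\<close>

text \<open>Powers with positive exponent on \<open>[0, \<infinity>]\<close>; it is never used with exponent \<open>\<le> 0\<close>.\<close>

definition ennreal_powr :: "ennreal \<Rightarrow> real \<Rightarrow> ennreal" where
  "ennreal_powr a p = (if a = \<infinity> then \<infinity> else ennreal (enn2real a powr p))"

text \<open>The argument plays the role of \<open>|g|\<close>; it may take the value \<open>\<infinity>\<close>, as is the case for maximal
  functions.\<close>

definition Lp_norm :: "real \<Rightarrow> ((nat \<Rightarrow> bit) \<Rightarrow> ennreal) \<Rightarrow> ennreal" where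
  "Lp_norm p g = ennreal_powr (\<integral>\<^sup>+ x. ennreal_powr (g x) p \<partial>walsh_measure) (1 / p)"

definition weak_Lp_norm :: "real \<Rightarrow> ((nat \<Rightarrow> bit) \<Rightarrow> real) \<Rightarrow> ennreal" where
  "weak_Lp_norm p g =
     ennreal_powr
       (SUP t\<in>{0<..}. ennreal (t powr p) * emeasure walsh_measure {x. \<bar>g x\<bar> > t}) (1 / p)"

subsection \<open>Dyadic martingales and Hardy spaces\<close>

definition dyadic_martingale :: "(nat \<Rightarrow> (nat \<Rightarrow> bit) \<Rightarrow> real) \<Rightarrow> bool" where
  "dyadic_martingale f \<longleftrightarrow>
     (\<forall>n. f n \<in> borel_measurable (dyadic_algebra n)) \<and>
     (\<forall>n. integrable walsh_measure (f n)) \<and>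
     (\<forall>m n. m \<le> n \<longrightarrow>
        (AE x in walsh_measure. real_cond_exp walsh_measure (dyadic_algebra m) (f n) x = f m x))"

definition maximal_function ::
  "(nat \<Rightarrow> (nat \<Rightarrow> bit) \<Rightarrow> real) \<Rightarrow> (nat \<Rightarrow> bit) \<Rightarrow> ennreal" where
  "maximal_function f x = (SUP n. ennreal \<bar>f n x\<bar>)"

definition hardy_norm :: "real \<Rightarrow> (nat \<Rightarrow> (nat \<Rightarrow> bit) \<Rightarrow> real) \<Rightarrow> ennreal" where
  "hardy_norm p f = Lp_norm p (maximal_function f)"

definition hardy_space :: "real \<Rightarrow> (nat \<Rightarrow> (nat \<Rightarrow> bit) \<Rightarrow> real) set" where
  "hardy_space p = {f. dyadic_martingale f \<and> hardy_norm p f < \<infinity>}"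

subsection \<open>Walsh--Fourier series of martingales\<close>

definition walsh_coeff :: "(nat \<Rightarrow> (nat \<Rightarrow> bit) \<Rightarrow> real) \<Rightarrow> nat \<Rightarrow> real" where
  "walsh_coeff f i = lim (\<lambda>k. \<integral>x. f k x * walsh i x \<partial>walsh_measure)"

definition partial_sum :: "nat \<Rightarrow> (nat \<Rightarrow> (nat \<Rightarrow> bit) \<Rightarrow> real) \<Rightarrow> (nat \<Rightarrow> bit) \<Rightarrow> real" where
  "partial_sum n f x = (\<Sum>k<n. walsh_coeff f k * walsh k x)"

definition norlund_log_mean ::
  "nat \<Rightarrow> (nat \<Rightarrow> (nat \<Rightarrow> bit) \<Rightarrow> real) \<Rightarrow> (nat \<Rightarrow> bit) \<Rightarrow> real" where
  "norlund_log_mean n f x = (1 / harm n) * (\<Sum>k<n. partial_sum k f x / real (n - k))"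

subsection \<open>Basic facts\<close>

lemma UNIV_bit: "(UNIV :: bit set) = {0, 1}"
  using bit.exhaust by blast

lemma emeasure_uniform_bit: "emeasure (uniform_count_measure (UNIV :: bit set)) {b} = 1 / 2"
  by (subst emeasure_uniform_count_measure) (auto simp: UNIV_bit divide_ennreal_def)

lemma prob_space_uniform_bit: "prob_space (uniform_count_measure (UNIV :: bit set))"
  by (rule prob_space_uniform_count_measure) (auto simp: UNIV_bit)

lemma prob_space_walsh_measure: "prob_space walsh_measure"
  unfolding walsh_measure_def by (intro prob_space_PiM prob_space_uniform_bit)

lemma space_walsh_measure: "space walsh_measure = UNIV"
  by (simp add: walsh_measure_def space_PiM space_uniform_count_measure)

lemma dyadic_interval_in_sets: "dyadic_interval n x \<in> sets walsh_measure"
proof -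
  have "{y \<in> space walsh_measure. \<forall>k<n. y k = x k} \<in> sets walsh_measure"
  proof (intro sets.sets_Collect_finite_All' sets.sets_Collect)
    fix k
    have "(\<lambda>y. y k) \<in> measurable walsh_measure (uniform_count_measure (UNIV :: bit set))"
      unfolding walsh_measure_def by (rule measurable_component_singleton) simp
    from measurable_sets[OF this, of "{x k}"]
    have "(\<lambda>y. y k) -` {x k} \<inter> space walsh_measure \<in> sets walsh_measure"
      by (simp add: sets_uniform_count_measure)
    moreover have "(\<lambda>y. y k) -` {x k} \<inter> space walsh_measure = {y \<in> space walsh_measure. y k = x k}"
      by auto
    ultimately show "{y \<in> space walsh_measure. y k = x k} \<in> sets walsh_measure"
      by simp
  qed
  then show ?thesis
    by (simp add: dyadic_interval_def space_walsh_measure)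
qed

lemma subalgebra_dyadic_algebra: "subalgebra walsh_measure (dyadic_algebra n)"
proof -
  have "range (dyadic_interval n) \<subseteq> sets walsh_measure"
    using dyadic_interval_in_sets by auto
  then have "sigma_sets UNIV (range (dyadic_interval n)) \<subseteq> sets walsh_measure"
    using sets.sigma_sets_subset[of "range (dyadic_interval n)" walsh_measure]
    by (simp add: space_walsh_measure)
  then show ?thesis
    by (simp add: subalgebra_def dyadic_algebra_def space_walsh_measure space_measure_of_conv)
qed

lemma walsh_eq_prod: "walsh n x = (\<Prod>k<n. rademacher k x ^ binary_digit n k)"
  unfolding walsh_def
proof (rule prodinf_finite)
  fix k assume "k \<notin> {..<n}"
  then have "n < 2 ^ k"
    by (meson lessThan_iff less_exp not_less order_le_less_trans)
  then show "rademacher k x ^ binary_digit n k = 1"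
    by (simp add: binary_digit_def)
qed simp

end

theory Submission
  imports Defs "HOL-Library.Discrete_Functions"
begin

text \<open>
  The witness is a lacunary martingale. Fix \<open>\<theta> > 1\<close> and give all Walsh coefficients with index in
  the block \<open>[2 ^ j, 2 ^ (j + 1))\<close> the same value, \<open>\<theta> ^ (j - 2)\<close> with truncated subtraction. The
  \<open>j\<close>-th block of the Walsh series is then, up to a sign, this value times the Dirichlet kernel of
  order \<open>2 ^ j\<close>, which equals \<open>2 ^ j\<close> on the dyadic interval of measure \<open>2 ^ - j\<close> around \<open>0\<close> and
  vanishes elsewhere.

  \<^emph>\<open>Membership in the Hardy space.\<close> As \<open>p \<le> 1\<close>, the \<open>p\<close>-th power of the maximal function is at
  most the sum of the \<open>p\<close>-th powers of the constant term and of the blocks, and the integral for the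
  \<open>j\<close>-th block is at most \<open>((2 * \<theta>) powr p / 2) ^ j\<close>. The series converges if \<open>\<theta> < 2 powr (1 / p - 1)\<close>, which leaves room
  for \<open>\<theta> > 1\<close> exactly because \<open>p < 1\<close>; the proof takes the square root of this bound.
  See \<open>walsh_series_dyadic_blocks_in_hardy_space\<close>.

  \<^emph>\<open>Growth of the means.\<close> On the set of measure \<open>1 / 4\<close> where the first two coordinates are \<open>1\<close>,
  four consecutive Walsh functions \<open>w\<^sub>4\<^sub>m, \<dots>, w\<^sub>4\<^sub>m\<^sub>+\<^sub>3\<close> are \<open>w, - w, - w, w\<close>. The coefficients are
  constant on such quadruples, so the partial sums there run through
  \<open>0, b m * w, 0, - b m * w\<close>, where \<open>b m\<close> is the coefficient of the quadruple. In the logarithmic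
  mean the weights of the two nonzero partial sums nearly cancel, except in the last quadruple, where
  they are \<open>1 / 3\<close> and \<open>1\<close>. As \<open>b\<close> is increasing, the last quadruple dominates all the others
  together, whatever their signs, and the mean of order \<open>2 ^ (n + 3)\<close> is at least a constant times
  \<open>\<theta> ^ n / n\<close>, the denominator coming from the harmonic number
  (\<open>norlund_sum_lower_bound\<close>, \<open>norlund_log_mean_lower_bound\<close>). This is unbounded on a fixed set of
  positive measure, hence so are the weak quasi-norms.
\<close>

section \<open>Binary digits and Walsh functions\<close>

lemma binary_digit_cases: "binary_digit n k = 0 \<or> binary_digit n k = 1"
  by (auto simp: binary_digit_def)

text \<open>The summands occupy disjoint digit positions, so no carry occurs.\<close>

lemma binary_digit_add_high:
  assumes "i < 2 ^ s"
  shows "binary_digit (2 ^ s * m + i) k = binary_digit (2 ^ s * m) k + binary_digit i k"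
proof (cases "k < s")
  case True
  then have *: "(2::nat) ^ s = 2 ^ k * (2 * 2 ^ (s - k - 1))"
    by (simp flip: power_add power_Suc)
  have "(2 ^ s * m + i) div 2 ^ k = (2 * 2 ^ (s - k - 1)) * m + i div 2 ^ k"
    by (subst *) (simp add: mult.assoc)
  moreover have "(2 ^ s * m) div 2 ^ k = 2 * (2 ^ (s - k - 1) * m)"
    by (subst *) (simp add: mult.assoc)
  ultimately show ?thesis
    by (simp add: binary_digit_def mult.assoc)
next
  case False
  then have *: "(2::nat) ^ k = 2 ^ s * 2 ^ (k - s)"
    by (simp flip: power_add)
  have "i div 2 ^ s = 0"
    using assms by simp
  then show ?thesis
    unfolding binary_digit_def * by (simp add: div_mult2_eq)
qed

lemma abs_rademacher [simp]: "\<bar>rademacher k x\<bar> = 1"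
  by (simp add: rademacher_def)

lemma walsh_eq_prod_lessThan:
  assumes "n < 2 ^ N"
  shows "walsh n x = (\<Prod>k<N. rademacher k x ^ binary_digit n k)"
  unfolding walsh_def
proof (rule prodinf_finite)
  fix k assume "k \<notin> {..<N}"
  then have "n < 2 ^ k"
    using assms by (meson lessThan_iff not_less one_le_numeral order_less_le_trans power_increasing)
  then show "rademacher k x ^ binary_digit n k = 1"
    by (simp add: binary_digit_def)
qed simp

lemma abs_walsh [simp]: "\<bar>walsh n x\<bar> = 1"
  by (simp add: walsh_eq_prod abs_prod power_abs)

lemma walsh_mult_self [simp]: "walsh n x * walsh n x = 1"
  by (metis abs_walsh abs_mult_self_eq mult_1)

lemma walsh_add_high:
  assumes "i < 2 ^ s"
  shows "walsh (2 ^ s * m + i) x = walsh (2 ^ s * m) x * walsh i x"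
proof -
  let ?N = "2 ^ s * m + i"
  have "walsh ?N x = (\<Prod>k<?N. rademacher k x ^ binary_digit (2 ^ s * m) k * rademacher k x ^ binary_digit i k)"
    by (simp only: walsh_eq_prod binary_digit_add_high[OF assms] power_add)
  also have "\<dots> = walsh (2 ^ s * m) x * walsh i x"
    using less_exp[of ?N]
    by (simp add: prod.distrib walsh_eq_prod_lessThan[where N = ?N] del: less_exp)
  finally show ?thesis .
qed

lemma walsh_0 [simp]: "walsh 0 x = 1"
  by (simp add: walsh_eq_prod)

lemma walsh_power_two: "walsh (2 ^ j) x = rademacher j x"
proof -
  have *: "binary_digit (2 ^ j) k = (if k = j then 1 else 0)" for k
  proof -
    have "k < j \<Longrightarrow> (2::nat) ^ j div 2 ^ k = 2 * 2 ^ (j - k - 1)"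
      by (simp add: power_diff_power_eq flip: power_Suc)
    then show ?thesis
      by (cases k j rule: linorder_cases) (auto simp: binary_digit_def)
  qed
  have "walsh (2 ^ j) x = (\<Prod>k<Suc j. if k = j then rademacher j x else 1)"
    by (subst walsh_eq_prod_lessThan[where N = "Suc j"]) (auto simp: * intro!: prod.cong)
  also have "\<dots> = rademacher j x"
    by (subst prod.delta) auto
  finally show ?thesis .
qed

lemma binary_digit_eqI:
  assumes "\<And>k. binary_digit m k = binary_digit n k"
  shows "m = n"
  by (rule bit_eqI) (metis assms binary_digit_def bit_iff_odd odd_iff_mod_2_eq_one)

section \<open>Invariance of the measure under coordinate flips\<close>

text \<open>Translation by the \<open>k\<close>-th unit vector of the group. It preserves the Haar measure and changes
  the sign of every Walsh function whose index has digit \<open>1\<close> at position \<open>k\<close>; every integral that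
  has to vanish below vanishes for this reason.\<close>

definition flip :: "nat \<Rightarrow> (nat \<Rightarrow> bit) \<Rightarrow> nat \<Rightarrow> bit" where
  "flip k x = x(k := x k + 1)"

lemma rademacher_flip: "rademacher j (flip k x) = (if j = k then - 1 else 1) * rademacher j x"
  by (auto simp: rademacher_def flip_def)

lemma walsh_flip: "walsh n (flip k x) = (- 1) ^ binary_digit n k * walsh n x"
proof -
  have N: "n < 2 ^ (n + k + 1)"
    by (rule less_le_trans[OF less_exp power_increasing]) simp_all
  have "walsh n (flip k x) =
      (\<Prod>j<n+k+1. (if j = k then (- 1) ^ binary_digit n k else 1) * rademacher j x ^ binary_digit n j)"
    unfolding walsh_eq_prod_lessThan[OF N]
    using binary_digit_cases[of n k] by (intro prod.cong) (auto simp: rademacher_flip)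
  also have "\<dots> = (- 1) ^ binary_digit n k * walsh n x"
    by (subst prod.distrib, subst prod.delta) (auto simp: walsh_eq_prod_lessThan[OF N])
  finally show ?thesis .
qed

lemma measurable_coordinate [measurable]:
  "(\<lambda>x. x k) \<in> measurable walsh_measure (count_space (UNIV :: bit set))"
proof -
  have "(\<lambda>x. x k) \<in> measurable walsh_measure (uniform_count_measure (UNIV :: bit set))"
    unfolding walsh_measure_def by (rule measurable_component_singleton) simp
  also have "measurable walsh_measure (uniform_count_measure (UNIV :: bit set)) =
      measurable walsh_measure (count_space (UNIV :: bit set))"
    by (rule measurable_cong_sets) (simp_all add: sets_uniform_count_measure)
  finally show ?thesis .
qed

lemma rademacher_measurable [measurable]: "rademacher k \<in> borel_measurable walsh_measure"
  unfolding rademacher_def[abs_def] by measurable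

lemma walsh_measurable [measurable]: "walsh n \<in> borel_measurable walsh_measure"
  unfolding walsh_eq_prod[abs_def] by measurable

interpretation walsh: prob_space walsh_measure
  by (rule prob_space_walsh_measure)

interpretation walsh_product:
  product_prob_space "\<lambda>_. uniform_count_measure (UNIV :: bit set)" "UNIV :: nat set"
  by (intro product_prob_spaceI prob_space_uniform_bit)

text \<open>Cylinder sets generate the product \<open>\<sigma>\<close>-algebra and determine the measure, so both the
  measure of dyadic intervals and the invariance under flips are read off from this formula.\<close>

lemma emeasure_cylinder:
  assumes "finite J"
  shows "emeasure walsh_measure {x. \<forall>j\<in>J. x j \<in> F j} =
    (\<Prod>j\<in>J. emeasure (uniform_count_measure (UNIV :: bit set)) (F j))"
  using walsh_product.emeasure_PiM_Collect[of J F] assms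
  by (simp add: walsh_measure_def[symmetric] space_walsh_measure sets_uniform_count_measure)

lemma emeasure_dyadic_interval: "emeasure walsh_measure (dyadic_interval n x) = ennreal (1 / 2 ^ n)"
proof -
  have "dyadic_interval n x = {y. \<forall>k\<in>{..<n}. y k \<in> {x k}}"
    by (auto simp: dyadic_interval_def)
  then have "emeasure walsh_measure (dyadic_interval n x) = (1 / 2) ^ n"
    by (simp only: emeasure_cylinder finite_lessThan emeasure_uniform_bit) simp
  also have "\<dots> = ennreal ((1 / 2) ^ n)"
    by (simp add: ennreal_power divide_ennreal_def inverse_ennreal flip: ennreal_power)
  finally show ?thesis
    by (simp add: power_one_over)
qed

lemma flip_measurable [measurable]: "flip k \<in> measurable walsh_measure walsh_measure"
proof -
  have "flip k \<in> measurable walsh_measure (\<Pi>\<^sub>M i\<in>UNIV. uniform_count_measure (UNIV :: bit set))"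
  proof (rule measurable_PiM_single')
    fix i
    have "(\<lambda>x. flip k x i) \<in> measurable walsh_measure (count_space (UNIV :: bit set))"
    proof (cases "i = k")
      case True
      have "(\<lambda>x. x k + 1) \<in> measurable walsh_measure (count_space (UNIV :: bit set))"
        by (rule measurable_compose[OF measurable_coordinate]) simp
      with True show ?thesis
        by (simp add: flip_def)
    next
      case False
      then show ?thesis
        by (simp add: flip_def)
    qed
    also have "measurable walsh_measure (count_space (UNIV :: bit set)) =
        measurable walsh_measure (uniform_count_measure (UNIV :: bit set))"
      by (rule measurable_cong_sets) (simp_all add: sets_uniform_count_measure)
    finally show "(\<lambda>x. flip k x i) \<in> measurable walsh_measure (uniform_count_measure UNIV)" .
  qed (simp add: space_uniform_count_measure)
  then show ?thesis
    by (simp add: walsh_measure_def)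
qed

lemma distr_flip: "distr walsh_measure walsh_measure (flip k) = walsh_measure"
proof -
  let ?B = "uniform_count_measure (UNIV :: bit set)"
  have "distr walsh_measure walsh_measure (flip k) = (\<Pi>\<^sub>M i\<in>UNIV. ?B)"
  proof (rule walsh_product.PiM_eq)
    show "sets (distr walsh_measure walsh_measure (flip k)) = sets (\<Pi>\<^sub>M i\<in>UNIV. ?B)"
      by (simp add: walsh_measure_def)
  next
    fix J :: "nat set" and F :: "nat \<Rightarrow> bit set"
    assume J: "finite J"
    let ?E = "prod_emb UNIV (\<lambda>_. ?B) J (Pi\<^sub>E J F)"
    let ?F = "\<lambda>j. if j = k then (\<lambda>b. b + 1) -` F j else F j"
    have "?E \<in> sets (\<Pi>\<^sub>M i\<in>UNIV. ?B)"
      using J by (intro sets_PiM_I) (auto simp: sets_uniform_count_measure)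
    then have E: "?E \<in> sets walsh_measure"
      by (simp add: walsh_measure_def)
    have "flip k -` ?E \<inter> space walsh_measure = {x. \<forall>j\<in>J. x j \<in> ?F j}"
      by (auto simp: prod_emb_def PiE_iff flip_def space_walsh_measure space_uniform_count_measure
          split: if_splits)
    then have "emeasure (distr walsh_measure walsh_measure (flip k)) ?E = (\<Prod>j\<in>J. emeasure ?B (?F j))"
      using E J by (simp add: emeasure_distr emeasure_cylinder)
    also have "\<dots> = (\<Prod>j\<in>J. emeasure ?B (F j))"
    proof (rule prod.cong)
      fix j
      have "bij (\<lambda>b::bit. b + 1)"
        by (rule bijI') (auto intro: exI[of _ "b + 1" for b] simp: add.assoc)
      then have "card ((\<lambda>b. b + 1) -` F j) = card (F j)"
        by (intro card_vimage_inj) (auto simp: bij_def)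
      then show "emeasure ?B (?F j) = emeasure ?B (F j)"
        by (subst (1 2) emeasure_uniform_count_measure) (auto simp: UNIV_bit)
    qed simp
    finally show "emeasure (distr walsh_measure walsh_measure (flip k)) ?E =
        (\<Prod>j\<in>J. emeasure ?B (F j))" .
  qed
  then show ?thesis
    by (simp add: walsh_measure_def)
qed

lemma integral_eq_0_if_flip_odd:
  fixes g :: "(nat \<Rightarrow> bit) \<Rightarrow> real"
  assumes [measurable]: "g \<in> borel_measurable walsh_measure" and odd: "\<And>x. g (flip k x) = - g x"
  shows "(\<integral>x. g x \<partial>walsh_measure) = 0"
proof -
  have "(\<integral>x. g x \<partial>walsh_measure) = (\<integral>x. g (flip k x) \<partial>walsh_measure)"
    by (subst distr_flip[of k, symmetric], subst integral_distr) simp_all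
  then show ?thesis
    by (simp add: odd)
qed

section \<open>Walsh series as dyadic martingales\<close>

text \<open>Distinct indices differ in some digit, and flipping that coordinate reverses the sign of the
  product.\<close>

lemma integral_walsh_mult:
  "(\<integral>x. walsh i x * walsh j x \<partial>walsh_measure) = (if i = j then 1 else 0)"
proof (cases "i = j")
  case True
  then show ?thesis
    by (simp add: walsh.prob_space)
next
  case False
  then obtain k where "binary_digit i k \<noteq> binary_digit j k"
    using binary_digit_eqI by blast
  then have "(- 1::real) ^ binary_digit i k * (- 1) ^ binary_digit j k = - 1"
    using binary_digit_cases[of i k] binary_digit_cases[of j k] by auto
  then have "(\<integral>x. walsh i x * walsh j x \<partial>walsh_measure) = 0"
    by (intro integral_eq_0_if_flip_odd[of _ k]) (simp_all add: walsh_flip mult_ac)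
  with False show ?thesis
    by simp
qed

lemma integrable_walsh [simp]: "integrable walsh_measure (walsh n)"
  by (rule walsh.integrable_const_bound[where B = 1]) auto

text \<open>Sets in the \<open>m\<close>-th dyadic algebra depend on the first \<open>m\<close> coordinates only.\<close>

lemma flip_invariant_dyadic_algebra:
  assumes "A \<in> sets (dyadic_algebra m)" "m \<le> k"
  shows "flip k x \<in> A \<longleftrightarrow> x \<in> A"
proof -
  have "A \<in> sigma_sets UNIV (range (dyadic_interval m))"
    using assms(1) by (simp add: dyadic_algebra_def)
  then show ?thesis
  proof (induction arbitrary: x rule: sigma_sets.induct)
    case (Basic A)
    then show ?case
      using assms(2) by (auto simp: dyadic_interval_def flip_def)
  qed auto
qed

text \<open>This is the martingale property: an index \<open>n \<ge> 2 ^ m\<close> has leading digit \<open>1\<close> at a position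
  \<open>\<ge> m\<close>, and flipping there fixes \<open>A\<close> but negates the Walsh function.\<close>

lemma set_integral_walsh_eq_0:
  assumes A: "A \<in> sets (dyadic_algebra m)" and n: "2 ^ m \<le> n"
  shows "(\<integral>x\<in>A. walsh n x \<partial>walsh_measure) = 0"
proof -
  have "binary_digit n (floor_log n) = 1"
  proof -
    have "n > 0"
      using n by (metis gr0I le_zero_eq power_not_zero zero_neq_numeral)
    then have "2 ^ floor_log n \<le> n" "n < 2 * 2 ^ floor_log n"
      by (simp_all add: floor_log_exp2_le floor_log_exp2_gt)
    then have "n div 2 ^ floor_log n = 1"
      by (intro div_nat_eqI) simp_all
    then show ?thesis
      by (simp add: binary_digit_def)
  qed
  moreover have "m \<le> floor_log n"
    using floor_log_le_iff[OF n] by simp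
  moreover have [measurable]: "A \<in> sets walsh_measure"
    using A subalgebra_dyadic_algebra[of m] by (auto simp: subalgebra_def)
  ultimately show ?thesis
    unfolding set_lebesgue_integral_def
    by (intro integral_eq_0_if_flip_odd[of _ "floor_log n"])
       (auto simp: walsh_flip indicator_def flip_invariant_dyadic_algebra[OF A])
qed

text \<open>There are only finitely many dyadic intervals of a given level, so unions of them stay in the
  generated \<open>\<sigma>\<close>-algebra.\<close>

lemma coordinate_in_dyadic_algebra:
  assumes "k < n"
  shows "{x. x k = b} \<in> sets (dyadic_algebra n)"
proof -
  have "range (dyadic_interval n) \<subseteq> (\<lambda>e. {y. \<forall>k<n. y k = e k}) ` ({..<n} \<rightarrow>\<^sub>E UNIV)"
  proof
    fix I assume "I \<in> range (dyadic_interval n)"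
    then obtain x where "I = dyadic_interval n x" by auto
    then have "I = {y. \<forall>k<n. y k = restrict x {..<n} k}"
      by (auto simp: dyadic_interval_def)
    then show "I \<in> (\<lambda>e. {y. \<forall>k<n. y k = e k}) ` ({..<n} \<rightarrow>\<^sub>E UNIV)"
      by (intro image_eqI[of _ _ "restrict x {..<n}"]) auto
  qed
  then have "finite (range (dyadic_interval n))"
    by (rule finite_subset) (auto intro!: finite_PiE simp: UNIV_bit)
  then have "countable (dyadic_interval n ` {x. x k = b})"
    by (meson countable_finite finite_subset image_mono subset_UNIV)
  then have "\<Union> (dyadic_interval n ` {x. x k = b}) \<in> sets (dyadic_algebra n)"
    by (intro sets.countable_Union) (auto simp: dyadic_algebra_def)
  also have "\<Union> (dyadic_interval n ` {x. x k = b}) = {x. x k = b}"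
    using assms by (auto simp: dyadic_interval_def)
  finally show ?thesis .
qed

lemma walsh_measurable_dyadic_algebra:
  assumes "i < 2 ^ n"
  shows "walsh i \<in> borel_measurable (dyadic_algebra n)"
proof -
  have [measurable]: "rademacher k \<in> borel_measurable (dyadic_algebra n)" if "k < n" for k
  proof -
    have "Measurable.pred (dyadic_algebra n) (\<lambda>x. x k = 0)"
      using coordinate_in_dyadic_algebra[OF that, of 0]
      by (simp add: pred_def dyadic_algebra_def space_measure_of_conv)
    then show ?thesis
      unfolding rademacher_def[abs_def] by measurable
  qed
  show ?thesis
    unfolding walsh_eq_prod_lessThan[OF assms, abs_def] by measurable
qed

text \<open>Dyadic partial sums of an arbitrary formal Walsh series. They form a martingale whose
  Walsh--Fourier coefficients are the given ones, so a martingale can be prescribed by its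
  coefficients.\<close>

definition walsh_series :: "(nat \<Rightarrow> real) \<Rightarrow> nat \<Rightarrow> (nat \<Rightarrow> bit) \<Rightarrow> real" where
  "walsh_series a n x = (\<Sum>i<2 ^ n. a i * walsh i x)"

lemma dyadic_martingale_walsh_series: "dyadic_martingale (walsh_series a)"
  unfolding dyadic_martingale_def
proof (intro conjI allI impI)
  show meas: "walsh_series a n \<in> borel_measurable (dyadic_algebra n)" for n
    unfolding walsh_series_def[abs_def]
    by (intro borel_measurable_sum borel_measurable_times walsh_measurable_dyadic_algebra) auto
  show int: "integrable walsh_measure (walsh_series a n)" for n
    unfolding walsh_series_def[abs_def] by simp
  fix m n :: nat assume "m \<le> n"
  interpret finite_measure_subalgebra walsh_measure "dyadic_algebra m"
    by unfold_locales (rule subalgebra_dyadic_algebra)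
  show "AE x in walsh_measure.
      real_cond_exp walsh_measure (dyadic_algebra m) (walsh_series a n) x = walsh_series a m x"
  proof (rule real_cond_exp_charact[OF _ int int meas])
    fix A assume A: "A \<in> sets (dyadic_algebra m)"
    then have [measurable]: "A \<in> sets walsh_measure"
      using subalgebra_dyadic_algebra[of m] by (auto simp: subalgebra_def)
    have iw: "set_integrable walsh_measure A (walsh i)" for i
      unfolding set_integrable_def by (intro integrable_mult_indicator) simp_all
    have eq: "(\<integral>x\<in>A. walsh_series a N x \<partial>walsh_measure) =
        (\<Sum>i<2 ^ N. a i * (\<integral>x\<in>A. walsh i x \<partial>walsh_measure))" for N
    proof -
      have "(\<integral>x\<in>A. walsh_series a N x \<partial>walsh_measure) =
          (\<integral>x. (\<Sum>i<2 ^ N. a i * (indicator A x *\<^sub>R walsh i x)) \<partial>walsh_measure)"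
        unfolding set_lebesgue_integral_def walsh_series_def
        by (simp add: sum_distrib_left mult_ac)
      also have "\<dots> = (\<Sum>i<2 ^ N. a i * (\<integral>x\<in>A. walsh i x \<partial>walsh_measure))"
        unfolding set_lebesgue_integral_def using iw
        by (subst Bochner_Integration.integral_sum) (simp_all add: set_integrable_def)
      finally show ?thesis .
    qed
    show "(\<integral>x\<in>A. walsh_series a n x \<partial>walsh_measure) = (\<integral>x\<in>A. walsh_series a m x \<partial>walsh_measure)"
      unfolding eq
    proof (rule sum.mono_neutral_right)
      show "{..<2 ^ m} \<subseteq> {..<(2::nat) ^ n}"
        using power_increasing[OF \<open>m \<le> n\<close>, of "2::nat"] by auto
    qed (auto simp: set_integral_walsh_eq_0[OF A] not_less)
  qed
qed

lemma walsh_coeff_walsh_series: "walsh_coeff (walsh_series a) j = a j"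
proof -
  (* the sequence under the limit is constant from index j on, as j < 2 ^ j *)
  have "(\<integral>x. walsh_series a k x * walsh j x \<partial>walsh_measure) = a j" if "j \<le> k" for k
  proof -
    have "integrable walsh_measure (\<lambda>x. walsh i x * walsh j x)" for i
      by (rule walsh.integrable_const_bound[where B = 1]) (auto simp: abs_mult)
    then have "(\<integral>x. walsh_series a k x * walsh j x \<partial>walsh_measure) =
        (\<Sum>i<2 ^ k. a i * (\<integral>x. walsh i x * walsh j x \<partial>walsh_measure))"
      by (simp add: walsh_series_def sum_distrib_right mult.assoc)
    also have "\<dots> = a j"
      using less_le_trans[OF less_exp[of j] power_increasing[OF that, of 2]]
      by (simp add: integral_walsh_mult if_distrib[of "\<lambda>z. _ * z"] sum.delta cong: if_cong)
    finally show ?thesis .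
  qed
  then have "(\<lambda>k. \<integral>x. walsh_series a k x * walsh j x \<partial>walsh_measure) \<longlonglongrightarrow> a j"
    by (intro tendsto_eventually eventually_sequentiallyI)
  then show ?thesis
    unfolding walsh_coeff_def by (rule limI)
qed

section \<open>Series with coefficients constant on dyadic blocks\<close>

definition dirichlet :: "nat \<Rightarrow> (nat \<Rightarrow> bit) \<Rightarrow> real" where
  "dirichlet n x = (\<Sum>i<n. walsh i x)"

lemma sum_lessThan_double:
  fixes g :: "nat \<Rightarrow> real"
  shows "(\<Sum>i<2 * n. g i) = (\<Sum>i<n. g i) + (\<Sum>i<n. g (n + i))"
  using sum.atLeastLessThan_concat[of 0 n "2 * n" g] sum.shift_bounds_nat_ivl[of g 0 n n]
  by (simp add: atLeast0LessThan mult_2 add.commute)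

lemma walsh_block: "i < 2 ^ n \<Longrightarrow> walsh (2 ^ n + i) x = rademacher n x * walsh i x"
  using walsh_add_high[of i n 1 x] by (simp add: walsh_power_two)

text \<open>Doubling the order multiplies the kernel by \<open>1 + rademacher n\<close>, which is \<open>2\<close> or \<open>0\<close>
  according to the \<open>n\<close>-th coordinate.\<close>

lemma dirichlet_power_two:
  "dirichlet (2 ^ n) x = 2 ^ n * indicator (dyadic_interval n (\<lambda>_. 0)) x"
proof (induction n)
  case 0
  then show ?case
    by (simp add: dirichlet_def dyadic_interval_def)
next
  case (Suc n)
  have "dirichlet (2 ^ Suc n) x = (1 + rademacher n x) * dirichlet (2 ^ n) x"
    by (simp add: dirichlet_def sum_lessThan_double walsh_block sum_distrib_left distrib_right
        sum.distrib)
  with Suc.IH show ?case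
    by (auto simp: rademacher_def dyadic_interval_def indicator_def less_Suc_eq)
qed

text \<open>The coefficient sequence with value \<open>c j\<close> on \<open>[2 ^ j, 2 ^ (j + 1))\<close>; since
  \<open>floor_log 0 = 0\<close>, index \<open>0\<close> also gets the value \<open>c 0\<close>.\<close>

definition dyadic_blocks :: "(nat \<Rightarrow> real) \<Rightarrow> nat \<Rightarrow> real" where
  "dyadic_blocks c i = c (floor_log i)"

lemma abs_walsh_series_dyadic_blocks_le:
  "\<bar>walsh_series (dyadic_blocks c) n x\<bar>
     \<le> \<bar>c 0\<bar> + (\<Sum>j<n. \<bar>c j\<bar> * 2 ^ j * indicator (dyadic_interval j (\<lambda>_. 0)) x)"
proof (induction n)
  case 0
  then show ?case
    by (simp add: walsh_series_def dyadic_blocks_def)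
next
  case (Suc n)
  have "dyadic_blocks c (2 ^ n + i) = c n" if "i < 2 ^ n" for i
    unfolding dyadic_blocks_def using that by (subst floor_log_eqI[of _ n]) auto
  then have "walsh_series (dyadic_blocks c) (Suc n) x =
      walsh_series (dyadic_blocks c) n x + c n * (rademacher n x * dirichlet (2 ^ n) x)"
    by (simp add: walsh_series_def dirichlet_def sum_lessThan_double walsh_block sum_distrib_left)
  moreover have "\<bar>c n * (rademacher n x * dirichlet (2 ^ n) x)\<bar> =
      \<bar>c n\<bar> * 2 ^ n * indicator (dyadic_interval n (\<lambda>_. 0)) x"
    by (simp add: abs_mult dirichlet_power_two)
  ultimately show ?case
    using Suc.IH abs_triangle_ineq[of "walsh_series (dyadic_blocks c) n x"
        "c n * (rademacher n x * dirichlet (2 ^ n) x)"]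
    by simp
qed

section \<open>Membership in the Hardy space\<close>

text \<open>With \<open>s = a / (a + b)\<close> this says \<open>1 \<le> s powr p + (1 - s) powr p\<close>, which holds because
  \<open>s \<le> s powr p\<close> on the unit interval.\<close>

lemma powr_add_le:
  fixes a b p :: real
  assumes "0 \<le> a" "0 \<le> b" "0 < p" "p \<le> 1"
  shows "(a + b) powr p \<le> a powr p + b powr p"
proof (cases "a + b = 0")
  case True
  with assms show ?thesis
    by simp
next
  case False
  with assms have s: "a + b > 0" by simp
  have *: "u / (a + b) * (a + b) powr p \<le> u powr p" if "0 \<le> u" "u \<le> a + b" for u
  proof -
    have "u / (a + b) \<le> (u / (a + b)) powr p"
      using powr_mono'[of p 1 "u / (a + b)"] that s assms by (simp add: divide_le_eq)
    then have "u / (a + b) * (a + b) powr p \<le> (u / (a + b)) powr p * (a + b) powr p"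
      by (intro mult_right_mono) auto
    also have "\<dots> = u powr p"
      using s that by (simp add: powr_divide)
    finally show ?thesis .
  qed
  have "(a + b) powr p = a / (a + b) * (a + b) powr p + b / (a + b) * (a + b) powr p"
    using s by (simp flip: distrib_right add_divide_distrib)
  also have "\<dots> \<le> a powr p + b powr p"
    using assms by (intro add_mono *) auto
  finally show ?thesis .
qed

lemma powr_sum_le:
  fixes u :: "'a \<Rightarrow> real"
  assumes "finite A" "\<And>i. i \<in> A \<Longrightarrow> 0 \<le> u i" "0 < p" "p \<le> 1"
  shows "(\<Sum>i\<in>A. u i) powr p \<le> (\<Sum>i\<in>A. u i powr p)"
  using assms(1,2)
proof (induction A rule: finite_induct)
  case (insert i A)
  have "(u i + (\<Sum>i\<in>A. u i)) powr p \<le> u i powr p + (\<Sum>i\<in>A. u i) powr p"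
    using insert assms by (intro powr_add_le sum_nonneg) auto
  with insert show ?case
    by fastforce
qed simp

lemma ennreal_powr_ennreal: "0 \<le> r \<Longrightarrow> ennreal_powr (ennreal r) p = ennreal (r powr p)"
  by (simp add: ennreal_powr_def)

lemma ennreal_powr_mono:
  assumes "a \<le> b" "0 < p"
  shows "ennreal_powr a p \<le> ennreal_powr b p"
proof (cases "b = \<infinity>")
  case True
  then show ?thesis
    by (simp add: ennreal_powr_def)
next
  case False
  with assms have "a \<noteq> \<infinity>"
    by (auto simp: top_unique)
  moreover have "enn2real a \<le> enn2real b"
    using False assms by (intro enn2real_mono) (simp_all add: less_top[symmetric])
  ultimately show ?thesis
    using False assms by (auto simp: ennreal_powr_def intro!: ennreal_leI powr_mono2)
qed

text \<open>Allows the maximal function to be estimated through the single members of the martingale,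
  also at points where it is infinite.\<close>

lemma ennreal_powr_SUP_le:
  fixes u :: "nat \<Rightarrow> real"
  assumes u: "\<And>n. 0 \<le> u n" and "0 < p" and le: "\<And>n. ennreal (u n powr p) \<le> B"
  shows "ennreal_powr (SUP n. ennreal (u n)) p \<le> B"
proof (cases B)
  case (real b)
  have "ennreal (u n) \<le> ennreal (b powr (1 / p))" for n
  proof -
    have "u n powr p \<le> b"
      using le[of n] real by simp
    then have "(u n powr p) powr (1 / p) \<le> b powr (1 / p)"
      using \<open>0 < p\<close> by (intro powr_mono2) auto
    then show ?thesis
      using u[of n] \<open>0 < p\<close> by (simp add: powr_powr ennreal_leI)
  qed
  then have "(SUP n. ennreal (u n)) \<le> ennreal (b powr (1 / p))"
    by (rule SUP_least)
  then have "ennreal_powr (SUP n. ennreal (u n)) p \<le> ennreal_powr (ennreal (b powr (1 / p))) p"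
    using \<open>0 < p\<close> by (rule ennreal_powr_mono)
  also have "\<dots> = B"
    using real \<open>0 < p\<close> by (simp add: ennreal_powr_ennreal powr_powr)
  finally show ?thesis .
qed simp

text \<open>The \<open>j\<close>-th summand in the hypothesis is the integral of the \<open>p\<close>-th power of the \<open>j\<close>-th block,
  and \<open>p \<le> 1\<close> makes the \<open>p\<close>-th power of the \<open>L\<^sub>p\<close> quasi-norm subadditive.\<close>

lemma walsh_series_dyadic_blocks_in_hardy_space:
  assumes p: "0 < p" "p \<le> 1"
    and summable: "summable (\<lambda>j. (\<bar>c j\<bar> * 2 ^ j) powr p / 2 ^ j)"
  shows "walsh_series (dyadic_blocks c) \<in> hardy_space p"
proof -
  let ?f = "walsh_series (dyadic_blocks c)"
  define v where "v j = (\<bar>c j\<bar> * 2 ^ j) powr p" for j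
  define Q where "Q x = ennreal (\<bar>c 0\<bar> powr p) +
    (\<Sum>j. ennreal (v j) * indicator (dyadic_interval j (\<lambda>_. 0)) x)" for x
  have bound: "ennreal_powr (maximal_function ?f x) p \<le> Q x" for x
    unfolding maximal_function_def
  proof (rule ennreal_powr_SUP_le)
    fix n
    let ?u = "\<lambda>j. \<bar>c j\<bar> * 2 ^ j * indicator (dyadic_interval j (\<lambda>_. 0)) x"
    have "\<bar>?f n x\<bar> powr p \<le> (\<bar>c 0\<bar> + (\<Sum>j<n. ?u j)) powr p"
      using p by (intro powr_mono2 abs_walsh_series_dyadic_blocks_le) auto
    also have "\<dots> \<le> \<bar>c 0\<bar> powr p + (\<Sum>j<n. ?u j) powr p"
      using p by (intro powr_add_le sum_nonneg) auto
    also have "(\<Sum>j<n. ?u j) powr p \<le> (\<Sum>j<n. ?u j powr p)"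
      using p by (intro powr_sum_le) auto
    also have "\<dots> = (\<Sum>j<n. v j * indicator (dyadic_interval j (\<lambda>_. 0)) x)"
      by (intro sum.cong) (auto simp: v_def indicator_def)
    finally have "ennreal (\<bar>?f n x\<bar> powr p) \<le>
        ennreal (\<bar>c 0\<bar> powr p + (\<Sum>j<n. v j * indicator (dyadic_interval j (\<lambda>_. 0)) x))"
      by (simp add: ennreal_leI)
    also have "\<dots> = ennreal (\<bar>c 0\<bar> powr p) + (\<Sum>j<n. ennreal (v j) * indicator (dyadic_interval j (\<lambda>_. 0)) x)"
      by (subst ennreal_plus)
         (auto simp: v_def sum_nonneg ennreal_mult ennreal_indicator simp flip: sum_ennreal)
    also have "\<dots> \<le> Q x"
      unfolding Q_def by (intro add_left_mono sum_le_suminf) auto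
    finally show "ennreal (\<bar>?f n x\<bar> powr p) \<le> Q x" .
  qed (use p in auto)
  have [measurable]: "dyadic_interval j (\<lambda>_. 0) \<in> sets walsh_measure" for j
    by (rule dyadic_interval_in_sets)
  have "(\<integral>\<^sup>+ x. ennreal_powr (maximal_function ?f x) p \<partial>walsh_measure) \<le> (\<integral>\<^sup>+ x. Q x \<partial>walsh_measure)"
    by (intro nn_integral_mono bound)
  also have "\<dots> = ennreal (\<bar>c 0\<bar> powr p) +
      (\<Sum>j. \<integral>\<^sup>+ x. ennreal (v j) * indicator (dyadic_interval j (\<lambda>_. 0)) x \<partial>walsh_measure)"
    unfolding Q_def
    by (subst nn_integral_add) (auto simp: nn_integral_suminf walsh.emeasure_space_1)
  also have "\<dots> = ennreal (\<bar>c 0\<bar> powr p) + (\<Sum>j. ennreal (v j / 2 ^ j))"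
    by (simp add: nn_integral_cmult_indicator emeasure_dyadic_interval v_def flip: ennreal_mult)
  also have "\<dots> < \<infinity>"
  proof -
    have "(\<Sum>j. ennreal (v j / 2 ^ j)) \<noteq> top"
      using summable by (intro ennreal_suminf_neq_top) (simp_all add: v_def)
    then show ?thesis
      by (simp add: less_top[symmetric])
  qed
  finally have "hardy_norm p ?f < \<infinity>"
    unfolding hardy_norm_def Lp_norm_def by (simp add: ennreal_powr_def)
  then show ?thesis
    by (simp add: hardy_space_def dyadic_martingale_walsh_series)
qed

section \<open>Growth of the logarithmic means\<close>

text \<open>Chebyshev's lower bound for the weak quasi-norm, from a bound on the set \<open>A\<close>.\<close>

lemma weak_Lp_norm_ge:
  assumes "0 < p" "0 < t" and [measurable]: "g \<in> borel_measurable walsh_measure"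
    and gt: "\<And>x. x \<in> A \<Longrightarrow> t < \<bar>g x\<bar>"
  shows "ennreal (t * measure walsh_measure A powr (1 / p)) \<le> weak_Lp_norm p g"
proof -
  have "{x. \<bar>g x\<bar> > t} = {x \<in> space walsh_measure. \<bar>g x\<bar> > t}"
    by (simp add: space_walsh_measure)
  then have "{x. \<bar>g x\<bar> > t} \<in> sets walsh_measure"
    by simp
  then have "emeasure walsh_measure A \<le> emeasure walsh_measure {x. \<bar>g x\<bar> > t}"
    using gt by (intro emeasure_mono) auto
  then have "ennreal (t powr p) * emeasure walsh_measure A
      \<le> (SUP t\<in>{0<..}. ennreal (t powr p) * emeasure walsh_measure {x. \<bar>g x\<bar> > t})"
    using \<open>0 < t\<close> by (intro SUP_upper2[of t] mult_left_mono) auto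
  then have "ennreal_powr (ennreal (t powr p * measure walsh_measure A)) (1 / p) \<le> weak_Lp_norm p g"
    unfolding weak_Lp_norm_def using \<open>0 < p\<close>
    by (intro ennreal_powr_mono) (auto simp: walsh.emeasure_eq_measure ennreal_mult)
  then show ?thesis
    using \<open>0 < p\<close> \<open>0 < t\<close> by (simp add: ennreal_powr_ennreal powr_mult powr_powr)
qed

lemma sum_lessThan_mult_4:
  fixes g :: "nat \<Rightarrow> real"
  shows "(\<Sum>k<4 * M. g k) =
    (\<Sum>m<M. g (4 * m) + g (4 * m + 1) + g (4 * m + 2) + g (4 * m + 3))"
proof (induction M)
  case (Suc M)
  have "4 * Suc M = Suc (Suc (Suc (Suc (4 * M))))"
    by simp
  with Suc show ?case
    by (simp only: sum.lessThan_Suc) (simp add: eval_nat_numeral)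
qed simp

text \<open>On \<open>x 0 = x 1 = 1\<close> the first four Walsh functions are \<open>1, - 1, - 1, 1\<close>, and the quadruple
  starting at \<open>4 * m\<close> is this pattern times \<open>walsh (4 * m)\<close>. Hence complete quadruples contribute
  nothing to the partial sums.\<close>

lemma partial_sum_quadruples:
  assumes x: "x 0 = 1" "x 1 = 1"
    and f: "\<And>m i. i < 4 \<Longrightarrow> walsh_coeff f (4 * m + i) = b m"
  shows "partial_sum (4 * m) f x = 0"
    and "partial_sum (4 * m + 1) f x = b m * walsh (4 * m) x"
    and "partial_sum (4 * m + 2) f x = 0"
    and "partial_sum (4 * m + 3) f x = - (b m * walsh (4 * m) x)"
proof -
  have w1: "walsh 1 x = - 1"
    using walsh_power_two[of 0 x] x by (simp add: rademacher_def)
  have w2: "walsh 2 x = - 1"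
    using walsh_power_two[of 1 x] x by (simp add: rademacher_def)
  have w3: "walsh 3 x = 1"
    using walsh_block[of 1 1 x] w1 x by (simp add: rademacher_def numeral_3_eq_3 numeral_2_eq_2)
  have w: "walsh (4 * m + i) x = walsh (4 * m) x * walsh i x" if "i < 4" for i m
    using walsh_add_high[of i 2 m x] that by simp
  have f0: "walsh_coeff f (4 * m) = b m" for m
    using f[of 0 m] by simp
  show *: "partial_sum (4 * m) f x = 0" for m
  proof -
    have "walsh_coeff f (4 * m) * walsh (4 * m) x + walsh_coeff f (4 * m + 1) * walsh (4 * m + 1) x +
        walsh_coeff f (4 * m + 2) * walsh (4 * m + 2) x + walsh_coeff f (4 * m + 3) * walsh (4 * m + 3) x = 0"
      for m
      using f[of 1 m] f[of 2 m] f[of 3 m] w[of 1 m] w[of 2 m] w[of 3 m]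
      by (simp add: f0 w1 w2 w3 del: One_nat_def)
    then show ?thesis
      unfolding partial_sum_def sum_lessThan_mult_4 by (intro sum.neutral ballI)
  qed
  have S: "partial_sum (Suc k) f x = partial_sum k f x + walsh_coeff f k * walsh k x" for k
    by (simp add: partial_sum_def)
  show 1: "partial_sum (4 * m + 1) f x = b m * walsh (4 * m) x"
    using S[of "4 * m"] by (simp add: * f0)
  show 2: "partial_sum (4 * m + 2) f x = 0"
    using S[of "4 * m + 1"] 1 f[of 1 m] w[of 1 m] w1 by simp
  show "partial_sum (4 * m + 3) f x = - (b m * walsh (4 * m) x)"
    using S[of "4 * m + 2"] 2 f[of 2 m] w[of 2 m] w2 by (simp add: numeral_3_eq_3)
qed

text \<open>The total weight left over, after cancellation, in all quadruples but the last. By convexity of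
  \<open>1 / t\<close>, half of the difference over an interval of length \<open>4\<close> dominates the difference over its
  second half, and the former telescopes. The bound \<open>1 / 6\<close> has to be compared with the weight
  \<open>1 - 1 / 3 = 2 / 3\<close> of the last quadruple.\<close>

lemma paired_weights_sum_le:
  "(\<Sum>m<K. 1 / (4 * real (K - m) + 1) - 1 / (4 * real (K - m) + 3)) \<le> 1 / 6"
proof -
  let ?g = "\<lambda>i. 1 / (4 * real i + 5) - 1 / (4 * real i + 7)"
  have "(\<Sum>m<K. 1 / (4 * real (K - m) + 1) - 1 / (4 * real (K - m) + 3)) = (\<Sum>m<K. ?g (K - Suc m))"
    by (intro sum.cong) (auto simp: of_nat_diff algebra_simps)
  also have "\<dots> = (\<Sum>i<K. ?g i)"
    by (rule sum.nat_diff_reindex)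
  also have "\<dots> \<le> (\<Sum>i<K. 1 / 2 * (1 / (4 * real i + 3) - 1 / (4 * real (Suc i) + 3)))"
  proof (rule sum_mono)
    fix i
    have half: "a - b \<le> 1 / 2 * (d - b)" if "a - b \<le> d - a" for a b d :: real
      using that by simp
    have "?g i \<le> 1 / (4 * real i + 3) - 1 / (4 * real i + 5)"
      by (simp add: field_simps, intro frac_le) (simp_all add: add_pos_nonneg)
    moreover have "4 * real (Suc i) + 3 = 4 * real i + 7"
      by simp
    ultimately show "?g i \<le> 1 / 2 * (1 / (4 * real i + 3) - 1 / (4 * real (Suc i) + 3))"
      by (simp only:) (rule half)
  qed
  also have "\<dots> = 1 / 2 * (1 / 3 - 1 / (4 * real K + 3))"
    unfolding sum_distrib_left[symmetric]
    by (subst sum_lessThan_telescope'[of "\<lambda>i. 1 / (4 * real i + 3)" K]) simp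
  also have "\<dots> \<le> 1 / 6"
    by simp
  finally show ?thesis .
qed

text \<open>The last quadruple contributes exactly \<open>2 / 3 * b K\<close> in absolute value and the others at most
  \<open>b K / 6\<close> together, by monotonicity of \<open>b\<close> and whatever the signs \<open>walsh (4 * m) x\<close> are.\<close>

lemma norlund_sum_lower_bound:
  assumes x: "x 0 = 1" "x 1 = 1"
    and f: "\<And>m i. i < 4 \<Longrightarrow> walsh_coeff f (4 * m + i) = b m"
    and b: "\<And>m. 0 \<le> b m" "mono b"
  shows "b K / 2 \<le> \<bar>\<Sum>k<4 * Suc K. partial_sum k f x / real (4 * Suc K - k)\<bar>"
proof -
  define h where "h m = 1 / (4 * real (K - m) + 1) - 1 / (4 * real (K - m) + 3)" for m
  define w where "w m = walsh (4 * m) x" for m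
  have h_nonneg: "0 \<le> h m" for m
    by (simp add: h_def field_simps)
  have "(\<Sum>k<4 * Suc K. partial_sum k f x / real (4 * Suc K - k)) =
      (\<Sum>m<Suc K. - (b m * w m * h m))"
    unfolding sum_lessThan_mult_4
  proof (rule sum.cong)
    fix m assume "m \<in> {..<Suc K}"
    then have "4 * Suc K - (4 * m + 1) = 4 * (K - m) + 3" "4 * Suc K - (4 * m + 3) = 4 * (K - m) + 1"
      by auto
    then show "partial_sum (4 * m) f x / real (4 * Suc K - 4 * m) +
        partial_sum (4 * m + 1) f x / real (4 * Suc K - (4 * m + 1)) +
        partial_sum (4 * m + 2) f x / real (4 * Suc K - (4 * m + 2)) +
        partial_sum (4 * m + 3) f x / real (4 * Suc K - (4 * m + 3)) = - (b m * w m * h m)"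
      by (simp only: partial_sum_quadruples[OF x f])
         (simp add: w_def h_def right_diff_distrib)
  qed simp
  also have "\<dots> = - ((\<Sum>m<K. b m * w m * h m) + b K * w K * (2 / 3))"
    by (simp add: sum_negf h_def)
  finally have eq: "\<bar>\<Sum>k<4 * Suc K. partial_sum k f x / real (4 * Suc K - k)\<bar> =
      \<bar>(\<Sum>m<K. b m * w m * h m) + b K * w K * (2 / 3)\<bar>"
    by (simp only: abs_minus_cancel)
  have "\<bar>\<Sum>m<K. b m * w m * h m\<bar> \<le> (\<Sum>m<K. b K * h m)"
    using b by (intro sum_abs[THEN order_trans] sum_mono)
      (auto simp: abs_mult w_def h_nonneg intro!: mult_right_mono elim: monoD)
  also have "\<dots> \<le> b K * (1 / 6)"
    unfolding sum_distrib_left[symmetric] h_def using b by (intro mult_left_mono paired_weights_sum_le)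
  finally have "\<bar>\<Sum>m<K. b m * w m * h m\<bar> \<le> b K / 6"
    by simp
  moreover have "\<bar>b K * w K * (2 / 3)\<bar> = b K * (2 / 3)"
    using b by (simp add: abs_mult w_def)
  ultimately show ?thesis
    unfolding eq by linarith
qed

lemma harm_power_two_le: "harm (2 ^ n) \<le> real n + 1"
proof -
  have "harm (2 ^ n) - ln (real (2 ^ n)) \<le> harm 1 - ln (real 1)"
    by (rule euler_mascheroni_sequence_decreasing) simp_all
  moreover have "harm 1 = (1::real)"
    by (simp add: harm_def)
  moreover have "real n * ln 2 \<le> real n"
    using ln_2_less_1 by (simp add: mult_left_le)
  ultimately show ?thesis
    by (simp add: ln_realpow del: One_nat_def)
qed

text \<open>Dividing by \<open>4\<close> removes two binary digits. For \<open>m = 0\<close> both sides are \<open>0\<close>, the left one by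
  truncation; this is why the exponent \<open>j - 2\<close> makes the coefficients constant on the very first
  quadruple too.\<close>

lemma floor_log_quadruple:
  assumes "i < 4"
  shows "floor_log (4 * m + i) - 2 = floor_log m"
proof -
  have "floor_log m = floor_log ((4 * m + i) div 2 div 2)"
    using assms by (intro arg_cong[of _ _ floor_log]) (simp flip: div_mult2_eq)
  also have "\<dots> = floor_log (4 * m + i) - 1 - 1"
    by (simp only: floor_log_half)
  finally show ?thesis
    by simp
qed

lemma norlund_log_mean_lower_bound:
  assumes x: "x 0 = 1" "x 1 = 1" and "1 \<le> \<theta>"
  shows "\<theta> ^ n / (2 * (real n + 4))
    \<le> \<bar>norlund_log_mean (2 ^ (n + 3)) (walsh_series (dyadic_blocks (\<lambda>j. \<theta> ^ (j - 2)))) x\<bar>"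
    (is "_ \<le> \<bar>norlund_log_mean _ ?f x\<bar>")
proof -
  (* K is the index of the last quadruple below 2 ^ (n + 3) *)
  define K :: nat where "K = 2 ^ (n + 1) - 1"
  have N: "2 ^ (n + 3) = 4 * Suc K"
    by (simp add: K_def power_add)
  have "(1::nat) \<le> 2 ^ n"
    by simp
  then have "0 < K" "2 ^ n \<le> K" "K < 2 * 2 ^ n"
    unfolding K_def power_add power_one_right by linarith+
  then have "floor_log K = n"
    by (rule floor_log_eqI)
  have "mono (\<lambda>m. \<theta> ^ floor_log m)"
    using \<open>1 \<le> \<theta>\<close> by (intro monoI power_increasing floor_log_le_iff)
  then have "\<theta> ^ floor_log K / 2 \<le> \<bar>\<Sum>k<4 * Suc K. partial_sum k ?f x / real (4 * Suc K - k)\<bar>"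
    using \<open>1 \<le> \<theta>\<close>
    by (intro norlund_sum_lower_bound[where b = "\<lambda>m. \<theta> ^ floor_log m"] x)
       (auto simp: walsh_coeff_walsh_series dyadic_blocks_def floor_log_quadruple)
  then have "\<theta> ^ n / 2 \<le> \<bar>\<Sum>k<2 ^ (n + 3). partial_sum k ?f x / real (2 ^ (n + 3) - k)\<bar>"
    unfolding N \<open>floor_log K = n\<close> .
  moreover have "0 < (harm (2 ^ (n + 3)) :: real)" "harm (2 ^ (n + 3)) \<le> real n + 4"
    using harm_power_two_le[of "n + 3"] by (simp_all add: harm_pos)
  ultimately have "\<theta> ^ n / 2 / (real n + 4) \<le>
      \<bar>\<Sum>k<2 ^ (n + 3). partial_sum k ?f x / real (2 ^ (n + 3) - k)\<bar> / harm (2 ^ (n + 3))"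
    by (intro frac_le) auto
  also have "\<dots> = \<bar>norlund_log_mean (2 ^ (n + 3)) ?f x\<bar>"
    using \<open>0 < harm (2 ^ (n + 3))\<close> by (simp add: norlund_log_mean_def abs_mult)
  finally show ?thesis
    by simp
qed

lemma filterlim_power_over_linear:
  fixes \<theta> :: real
  assumes "1 < \<theta>"
  shows "filterlim (\<lambda>n. \<theta> ^ n / (real n + 4)) at_top sequentially"
proof -
  have "(\<lambda>n. real n / \<theta> ^ n + 4 / \<theta> ^ n) \<longlonglongrightarrow> 0 + 0"
    using assms by (intro tendsto_add lim_n_over_pown LIMSEQ_divide_realpow_zero) auto
  then have "(\<lambda>n. (real n + 4) / \<theta> ^ n) \<longlonglongrightarrow> 0"
    by (simp add: add_divide_distrib)
  then have "filterlim (\<lambda>n. inverse ((real n + 4) / \<theta> ^ n)) at_top sequentially"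
    using assms by (intro filterlim_inverse_at_top always_eventually) (auto intro!: divide_pos_pos)
  then show ?thesis
    by simp
qed

section \<open>The counterexample\<close>

theorem theorem2:
  fixes p :: real
  assumes "0 < p" and "p < 1"
  shows "\<exists>f. f \<in> hardy_space p \<and>
           (SUP n. weak_Lp_norm p (norlund_log_mean (2 ^ n) f)) = \<infinity>"
proof -
  (* any ratio strictly between 1 and 2 powr (1 / p - 1) would do *)
  define \<theta> :: real where "\<theta> = 2 powr ((1 / p - 1) / 2)"
  define f where "f = walsh_series (dyadic_blocks (\<lambda>j. \<theta> ^ (j - 2)))"
  have "1 < \<theta>"
    using assms by (simp add: \<theta>_def)

  have ratio: "(\<theta> * 2) powr p / 2 = 2 powr - ((1 - p) / 2)"
  proof -
    have "(\<theta> * 2) powr p = 2 powr (p * ((1 / p - 1) / 2) + p)"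
      by (simp add: \<theta>_def powr_mult powr_powr powr_add mult.commute)
    also have "p * ((1 / p - 1) / 2) + p = - ((1 - p) / 2) + 1"
      using assms by (simp add: field_simps)
    also have "2 powr (- ((1 - p) / 2) + 1) = 2 powr - ((1 - p) / 2) * (2::real)"
      by (subst powr_add) simp
    finally show ?thesis
      by simp
  qed
  have "f \<in> hardy_space p"
    unfolding f_def
  proof (rule walsh_series_dyadic_blocks_in_hardy_space)
    have "summable (\<lambda>j. ((\<theta> * 2) powr p / 2) ^ j)"
      using assms powr_less_mono[of "- ((1 - p) / 2)" 0 2]
      by (intro summable_geometric) (simp add: ratio)
    then show "summable (\<lambda>j. (\<bar>\<theta> ^ (j - 2)\<bar> * 2 ^ j) powr p / 2 ^ j)"
    proof (rule summable_comparison_test'[where N = 0])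
      fix j
      have "\<theta> ^ (j - 2) * 2 ^ j \<le> (\<theta> * 2) ^ j"
        unfolding power_mult_distrib using \<open>1 < \<theta>\<close>
        by (intro mult_right_mono power_increasing) auto
      then have "(\<theta> ^ (j - 2) * 2 ^ j) powr p \<le> ((\<theta> * 2) ^ j) powr p"
        using \<open>1 < \<theta>\<close> assms by (intro powr_mono2) auto
      also have "\<dots> = ((\<theta> * 2) powr p) ^ j"
      proof -
        have power_powr: "(r ^ j) powr p = (r powr p) ^ j" if "0 < r" for r :: real
          using that by (simp add: powr_powr mult.commute flip: powr_realpow)
        show ?thesis
          by (rule power_powr) (use \<open>1 < \<theta>\<close> in simp)
      qed
      finally show "norm ((\<bar>\<theta> ^ (j - 2)\<bar> * 2 ^ j) powr p / 2 ^ j) \<le> ((\<theta> * 2) powr p / 2) ^ j"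
        using \<open>1 < \<theta>\<close> by (simp add: power_divide divide_right_mono)
    qed
  qed (use assms in auto)

  (* 1 / 4 in the base is the measure of the set x 0 = x 1 = 1; the final factor 1 / 4 is half of the
     1 / 2 in the pointwise bound, since the weak quasi-norm needs a strict inequality *)
  define C where "C = (1 / 4 :: real) powr (1 / p) / 4"
  have lower: "ennreal (C * (\<theta> ^ n / (real n + 4))) \<le> weak_Lp_norm p (norlund_log_mean (2 ^ (n + 3)) f)"
    for n
  proof -
    define t where "t = \<theta> ^ n / (real n + 4) / 4"
    let ?A = "dyadic_interval 2 (\<lambda>_. 1)"
    have t: "0 < t"
      using \<open>1 < \<theta>\<close> by (simp add: t_def)
    have "ennreal (t * measure walsh_measure ?A powr (1 / p)) \<le>
        weak_Lp_norm p (norlund_log_mean (2 ^ (n + 3)) f)"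
    proof (rule weak_Lp_norm_ge[OF assms(1) t])
      show "norlund_log_mean (2 ^ (n + 3)) f \<in> borel_measurable walsh_measure"
        unfolding norlund_log_mean_def[abs_def] partial_sum_def by measurable
    next
      fix x assume "x \<in> ?A"
      then have "\<theta> ^ n / (2 * (real n + 4)) \<le> \<bar>norlund_log_mean (2 ^ (n + 3)) f x\<bar>"
        unfolding f_def using \<open>1 < \<theta>\<close>
        by (intro norlund_log_mean_lower_bound) (auto simp: dyadic_interval_def)
      moreover have "\<theta> ^ n / (2 * (real n + 4)) = 2 * t"
        by (simp add: t_def field_simps)
      ultimately show "t < \<bar>norlund_log_mean (2 ^ (n + 3)) f x\<bar>"
        using t by linarith
    qed
    moreover have "measure walsh_measure ?A = 1 / 4"
      by (simp add: measure_def emeasure_dyadic_interval)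
    ultimately show ?thesis
      by (simp add: C_def t_def mult_ac)
  qed
  have unbounded: "filterlim (\<lambda>n. C * (\<theta> ^ n / (real n + 4))) at_top sequentially"
    by (rule filterlim_tendsto_pos_mult_at_top[OF tendsto_const _ filterlim_power_over_linear])
       (simp_all add: C_def \<open>1 < \<theta>\<close>)
  have "(SUP n. weak_Lp_norm p (norlund_log_mean (2 ^ n) f)) = \<infinity>"
  proof (cases "SUP n. weak_Lp_norm p (norlund_log_mean (2 ^ n) f)")
    case (real r)
    obtain n where "r < C * (\<theta> ^ n / (real n + 4))"
      using unbounded by (auto simp: filterlim_at_top_dense eventually_sequentially)
    moreover have "ennreal (C * (\<theta> ^ n / (real n + 4))) \<le> ennreal r"
      unfolding real(2)[symmetric] by (rule order_trans[OF lower]) (rule SUP_upper, simp)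
    ultimately show ?thesis
      using real(1) by simp
  qed simp
  with \<open>f \<in> hardy_space p\<close> show ?thesis
    by blast
qed

end
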